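(* Let $\mathcal S\subset\mathbb{R}^{\mathcal M}$, $\mathbf u^*\in\mathcal S$ and the local parametrization $U:\mathcal Q^0\subset\mathbb R^q\to\mathbb R^{\mathcal M}$ of $\mathcal S$ with $U(\boldsymbol 0)=\mathbf u^*$ be as in the context, and for small $r>0$ let $\mathcal S^{r}=\{U(\boldsymbol\nu):\boldsymbol\nu\in\mathcal B(\boldsymbol 0,r)\}$. Then, for all sufficiently small $r>0$, \[ n_s(\mathcal S^{r})=q . \]
   Context: Setting. $\mathcal S$ is an embedded submanifold of dimension $q$ of $X=\mathbb R^{\mathcal M}$ ($\mathcal M\gg q$), and $\mathbf u^*\in\mathcal S$. $U:\mathcal Q^0\to\mathbb R^{\mathcal M}$ is the inverse of a chart of $\mathcal S$ around $\mathbf u^*$: $\mathcal Q^0\subset\mathbb R^q$ is open and contains the closed unit ball $\mathcal B(\boldsymbol 0,1)$, $U$ is a homeomorphism onto an open subset of $\mathcal S$, and $U(\boldsymbol 0)=\mathbf u^*$. Standing assumptions: $U$ is of class $C^3$; at every point of $\mathcal Q^0$ the Jacobian $\mathbf J_U(\boldsymbol\nu)\in\mathbb R^{\mathcal M\times q}$ has rank $q$, and the second fundamental form has maximal rank, i.e. the components of the second derivatives $\partial_{\nu_j}\partial_{\nu_\ell}U$, $1\le j\le\ell\le q$, orthogonal to the tangent space $\mathrm{Range}(\mathbf J_U(\boldsymbol\nu))$ span a space of dimension $\tfrac12q(q+1)$. $\mathcal B(\boldsymbol 0,r)$ denotes the closed Euclidean ball of radius $r$ in $\mathbb R^q$. Sensing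 numbers. For a set $\mathcal K\subset X$ and $n\in\mathbb N$, \[ s_n(\mathcal K):=\inf_{\substack{D\in\mathcal C(\mathbb R^n,X)\\ \ell_1,\dots,\ell_n\in X'}}\ \sup_{u\in\mathcal K}\big\|u-D(\ell_1(u),\dots,\ell_n(u))\big\|_X, \] where $\mathcal C(\mathbb R^n,X)$ is the set of continuous maps and $X'$ is the (continuous) dual of $X$. The associated minimal latent dimension is $n_s(\mathcal K):=\min\{n\in\mathbb N: s_n(\mathcal K)=0\}$. *)

theory Defs
  imports "HOL-Analysis.Analysis"
begin

(* Class C^k on an open set S. Differentiability is required at each order, so that every
   frechet_derivative below is a genuine derivative. *)
primrec C_k_on :: "nat \<Rightarrow> ('a::real_normed_vector \<Rightarrow> 'b::real_normed_vector) \<Rightarrow> 'a set \<Rightarrow> bool" where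
  "C_k_on 0 f S \<longleftrightarrow> continuous_on S f"
| "C_k_on (Suc k) f S \<longleftrightarrow> (\<forall>x\<in>S. f differentiable (at x)) \<and>
     (\<forall>v. C_k_on k (\<lambda>x. frechet_derivative f (at x) v) S)"

(* Slice-chart definition: near each of its points, S is flattened onto a q-dimensional
   linear subspace T by a C^k diffeomorphism between open subsets of the ambient space. *)
definition embedded_submanifold :: "nat \<Rightarrow> nat \<Rightarrow> 'a::euclidean_space set \<Rightarrow> bool" where
  "embedded_submanifold k q S \<longleftrightarrow>
     (\<forall>p\<in>S. \<exists>W W' \<Phi> \<Psi> (T :: 'a set).
        open W \<and> p \<in> W \<and> open W' \<and> homeomorphism W W' \<Phi> \<Psi> \<and>
        C_k_on k \<Phi> W \<and> C_k_on k \<Psi> W' \<and>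
        subspace T \<and> dim T = q \<and> \<Phi> ` (S \<inter> W) = T \<inter> W')"

definition partial_deriv :: "'q::finite \<Rightarrow> (real^'q \<Rightarrow> 'b::real_normed_vector) \<Rightarrow> real^'q \<Rightarrow> 'b" where
  "partial_deriv j f x = vector_derivative (\<lambda>t. f (x + t *\<^sub>R axis j 1)) (at 0)"

definition tangent_space :: "(real^'q \<Rightarrow> real^'m) \<Rightarrow> real^'q \<Rightarrow> (real^'m) set" where
  "tangent_space U \<nu> = range (\<lambda>v. jacobian U (at \<nu>) *v v)"

(* The component of v orthogonal to the subspace T. *)
definition orthogonal_component :: "'a::euclidean_space set \<Rightarrow> 'a \<Rightarrow> 'a" where
  "orthogonal_component T v = (THE w. w \<in> T\<^sup>\<bottom> \<and> v - w \<in> T)"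

(* The vectors below are indexed by all pairs (j, l): the index type carries no order, and for
   U of class C^2 the pairs with j > l only repeat vectors already present. *)
definition second_fundamental_form_max_rank :: "(real^'q \<Rightarrow> real^'m) \<Rightarrow> real^'q \<Rightarrow> bool" where
  "second_fundamental_form_max_rank U \<nu> \<longleftrightarrow>
     dim (span {orthogonal_component (tangent_space U \<nu>) (partial_deriv j (partial_deriv l U) \<nu>) | j l. True})
       = CARD('q) * (CARD('q) + 1) div 2"

(* Euclidean_space n is R^n, realised as the sequences vanishing from index n on; only the
   functionals l 0, ..., l (n - 1) are used. Values are in ennreal because the supremum may be
   infinite for unbounded K. *)
definition sensing_number :: "nat \<Rightarrow> 'a::real_normed_vector set \<Rightarrow> ennreal" where
  "sensing_number n K =
     (INF (D, l) \<in> {(D :: (nat \<Rightarrow> real) \<Rightarrow> 'a, l :: nat \<Rightarrow> 'a \<Rightarrow>\<^sub>L real).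
                      continuous_map (Euclidean_space n) euclidean D}.
        SUP u \<in> K. ennreal (norm (u - D (\<lambda>i. if i < n then blinfun_apply (l i) u else 0))))"

(* The infimum in enat is a minimum, except that it is infinite if no n qualifies. *)
definition minimal_latent_dim :: "'a::real_normed_vector set \<Rightarrow> enat" where
  "minimal_latent_dim K = Inf {enat n | n. sensing_number n K = 0}"

end

theory Submission
  imports Defs
begin

text \<open>
  Let \<open>J\<close> be the derivative of \<open>U\<close> at the origin. It is injective by the rank condition, so it has
  a linear left inverse \<open>A\<close>, and \<open>A \<circ> U\<close> is close to a translation near the origin:
  \<open>A (U x) - A (U y)\<close> differs from \<open>x - y\<close> by at most half of \<open>\<parallel>x - y\<parallel>\<close>.

  Hence \<open>A \<circ> U\<close> is injective on a small closed ball. The \<open>q\<close> coordinates of \<open>A\<close> are then linear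
  functionals that determine the points of the patch, and by compactness the decoding is
  continuous; it extends to the whole space by Tietze's theorem. So the \<open>q\<close>-th sensing number
  vanishes (\<open>sensing_number_eq_0\<close>).

  Conversely, suppose that \<open>n < q\<close> functionals and a continuous decoder \<open>D\<close> reconstruct the patch
  with a small uniform error. Then the ball is mapped continuously into a hyperplane (the \<open>n\<close>
  measurements padded by zeros) and from there, by \<open>A \<circ> D\<close>, back into \<open>q\<close>-space in such a way that
  each point moves, up to a fixed translation, by at most a constant less than the radius. By
  Brouwer's theorem the image contains a ball (\<open>near_translation_covers_ball\<close>). But the second
  map can be replaced by a polynomial map close to it, and a polynomial map sends a hyperplane to
  a null set (\<open>no_near_translation_through_hyperplane\<close>). The admissible error depends only on the
  radius and on \<open>A\<close>, not on the functionals or on \<open>D\<close>, so the infimum is positive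
  (\<open>sensing_number_neq_0\<close>).
\<close>

section \<open>Strict differentiability of continuously differentiable maps\<close>

lemma C_k_on_Suc_imp: "C_k_on (Suc k) f S \<Longrightarrow> C_k_on k f S"
proof (induction k arbitrary: f)
  case 0
  then show ?case
    by (auto intro!: continuous_at_imp_continuous_on differentiable_imp_continuous_within)
next
  case (Suc k)
  then show ?case by (metis C_k_on.simps(2))
qed

lemma onorm_le_sum_Basis:
  fixes f :: "'a::euclidean_space \<Rightarrow> 'b::real_normed_vector"
  assumes "linear f"
  shows "onorm f \<le> (\<Sum>b\<in>Basis. norm (f b))"
proof (rule onorm_le)
  fix x
  have "f x = f (\<Sum>b\<in>Basis. (x \<bullet> b) *\<^sub>R b)"
    by (simp add: euclidean_representation)
  also have "\<dots> = (\<Sum>b\<in>Basis. (x \<bullet> b) *\<^sub>R f b)"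
    by (simp add: linear_sum[OF assms] linear_cmul[OF assms])
  finally have "norm (f x) \<le> (\<Sum>b\<in>Basis. \<bar>x \<bullet> b\<bar> * norm (f b))"
    by (metis (mono_tags, lifting) norm_scaleR norm_sum sum.cong)
  also have "\<dots> \<le> (\<Sum>b\<in>Basis. norm (f b) * norm x)"
    by (intro sum_mono) (metis Basis_le_norm mult.commute mult_left_mono norm_ge_zero)
  finally show "norm (f x) \<le> (\<Sum>b\<in>Basis. norm (f b)) * norm x"
    by (simp add: sum_distrib_right)
qed

lemma C1_strictly_differentiable:
  fixes f :: "'a::euclidean_space \<Rightarrow> 'b::real_normed_vector"
  assumes "C_k_on 1 f S" "open S" "a \<in> S" "e > 0"
  obtains d where "d > 0" "ball a d \<subseteq> S"
    "\<And>x y. x \<in> ball a d \<Longrightarrow> y \<in> ball a d \<Longrightarrow>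
       norm (f x - f y - frechet_derivative f (at a) (x - y)) \<le> e * norm (x - y)"
proof -
  let ?D = "\<lambda>x. frechet_derivative f (at x)"
  have der: "(f has_derivative ?D x) (at x)" if "x \<in> S" for x
    using assms(1) that by (simp add: frechet_derivative_works)
  have lin: "linear (?D x)" if "x \<in> S" for x
    using der[OF that] has_derivative_linear by blast
  have "continuous (at a) (\<lambda>x. ?D x b)" for b
    using assms by (simp add: continuous_on_eq_continuous_at)
  then have "((\<lambda>x. \<Sum>b\<in>Basis. norm (?D x b - ?D a b)) \<longlongrightarrow> (\<Sum>b\<in>Basis. norm (?D a b - ?D a b))) (at a)"
    by (intro tendsto_intros) (simp add: isCont_def)
  then have "\<forall>\<^sub>F x in at a. (\<Sum>b\<in>Basis. norm (?D x b - ?D a b)) < e"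
    using \<open>e > 0\<close> by (simp add: order_tendstoD(2))
  moreover have "\<forall>\<^sub>F x in at a. x \<in> S"
    using assms eventually_at_topological by blast
  ultimately have "\<forall>\<^sub>F x in at a. x \<in> S \<and> (\<Sum>b\<in>Basis. norm (?D x b - ?D a b)) < e"
    by eventually_elim auto
  then obtain d where "d > 0"
    and d': "\<And>x. x \<noteq> a \<Longrightarrow> dist x a < d \<Longrightarrow> x \<in> S \<and> (\<Sum>b\<in>Basis. norm (?D x b - ?D a b)) < e"
    unfolding eventually_at by blast
  have d: "x \<in> S \<and> (\<Sum>b\<in>Basis. norm (?D x b - ?D a b)) < e" if "x \<in> ball a d" for x
    using d'[of x] that \<open>a \<in> S\<close> \<open>e > 0\<close> by (cases "x = a") (auto simp: dist_commute)
  show thesis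
  proof
    show "d > 0" by fact
    show "ball a d \<subseteq> S" using d by blast
    fix x y assume xy: "x \<in> ball a d" "y \<in> ball a d"
    have "norm ((f x - ?D a x) - (f y - ?D a y)) \<le> e * norm (x - y)"
    proof (rule differentiable_bound[OF convex_ball[of a d] _ _ xy])
      fix z assume z: "z \<in> ball a d"
      have "bounded_linear (?D a)"
        using lin[OF \<open>a \<in> S\<close>] by (simp add: linear_conv_bounded_linear)
      then show "((\<lambda>z. f z - ?D a z) has_derivative (\<lambda>h. ?D z h - ?D a h)) (at z within ball a d)"
        using der d z
        by (intro has_derivative_diff bounded_linear_imp_has_derivative)
           (auto intro: has_derivative_at_withinI)
      have "linear (\<lambda>h. ?D z h - ?D a h)"
        using lin d z \<open>a \<in> S\<close> by (intro linear_compose_sub) auto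
      then show "onorm (\<lambda>h. ?D z h - ?D a h) \<le> e"
        using onorm_le_sum_Basis d[OF z] by fastforce
    qed
    then show "norm (f x - f y - ?D a (x - y)) \<le> e * norm (x - y)"
      by (simp add: linear_diff[OF lin[OF \<open>a \<in> S\<close>]] algebra_simps)
  qed
qed

text \<open>The coordinate change that turns an immersion into a small Lipschitz perturbation of a
  translation: compose with a left inverse of the derivative.\<close>
lemma immersion_near_translation:
  fixes f :: "'a::euclidean_space \<Rightarrow> 'b::euclidean_space"
  assumes "C_k_on 1 f S" "open S" "0 \<in> S" "inj (frechet_derivative f (at 0))"
  obtains A d where "bounded_linear A" "d > 0" "ball 0 d \<subseteq> S"
    "\<And>x y. x \<in> ball 0 d \<Longrightarrow> y \<in> ball 0 d \<Longrightarrow>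
       norm (A (f x) - A (f y) - (x - y)) \<le> norm (x - y) / 2"
proof -
  let ?J = "frechet_derivative f (at 0)"
  have "linear ?J"
    using assms by (auto intro: linear_frechet_derivative)
  then obtain A where A: "linear A" "A \<circ> ?J = id"
    using linear_injective_left_inverse assms(4) by blast
  then have bl: "bounded_linear A"
    by (simp add: linear_linear)
  obtain B where B: "B > 0" "\<And>x. norm (A x) \<le> B * norm x"
    using linear_bounded_pos[OF A(1)] by blast
  obtain d where d: "d > 0" "ball 0 d \<subseteq> S"
    "\<And>x y. x \<in> ball 0 d \<Longrightarrow> y \<in> ball 0 d \<Longrightarrow>
       norm (f x - f y - ?J (x - y)) \<le> 1 / (2 * B) * norm (x - y)"
    using C1_strictly_differentiable[OF assms(1-3), of "1 / (2 * B)"] B by auto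
  show thesis
  proof (rule that[OF bl d(1,2)])
    fix x y :: 'a assume xy: "x \<in> ball 0 d" "y \<in> ball 0 d"
    have "A (?J (x - y)) = x - y"
      using A(2) by (metis comp_apply id_apply)
    then have "norm (A (f x) - A (f y) - (x - y)) = norm (A (f x - f y - ?J (x - y)))"
      by (simp add: linear_diff[OF A(1)])
    also have "\<dots> \<le> B * (1 / (2 * B) * norm (x - y))"
      using B(2) d(3)[OF xy] \<open>B > 0\<close> by (meson mult_left_mono order_less_imp_le order_trans)
    finally show "norm (A (f x) - A (f y) - (x - y)) \<le> norm (x - y) / 2"
      using \<open>B > 0\<close> by simp
  qed
qed

section \<open>Maps close to a translation do not factor through a hyperplane\<close>

text \<open>A point \<open>y\<close> is attained by \<open>g\<close> exactly when \<open>x \<mapsto> x - g x + y\<close> has a fixed point; for \<open>y\<close>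
  near \<open>a\<close> this map sends the ball into itself.\<close>
lemma near_translation_covers_ball:
  fixes g :: "'a::euclidean_space \<Rightarrow> 'a"
  assumes "continuous_on (cball 0 r) g" "0 < r" "s < r"
    and near: "\<And>x. x \<in> cball 0 r \<Longrightarrow> norm (g x - a - x) \<le> s"
  shows "cball a (r - s) \<subseteq> g ` cball 0 r"
proof
  fix y assume y: "y \<in> cball a (r - s)"
  have "cball (0::'a) r \<noteq> {}"
    using \<open>0 < r\<close> by simp
  then obtain x where x: "x \<in> cball 0 r" "x - g x + y = x"
  proof (rule brouwer[OF compact_cball convex_cball, where f = "\<lambda>x. x - g x + y"])
    show "continuous_on (cball 0 r) (\<lambda>x. x - g x + y)"
      using assms(1) by (intro continuous_intros)
    show "(\<lambda>x. x - g x + y) \<in> cball 0 r \<rightarrow> cball 0 r"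
    proof
      fix x :: 'a assume x: "x \<in> cball 0 r"
      have "norm (x - g x + y) = norm ((y - a) - (g x - a - x))"
        by (simp add: algebra_simps)
      also have "\<dots> \<le> norm (y - a) + norm (g x - a - x)"
        by (rule norm_triangle_ineq4)
      also have "\<dots> \<le> r"
        using y near[OF x] by (simp add: dist_norm norm_minus_commute)
      finally show "x - g x + y \<in> cball 0 r" by simp
    qed
  qed auto
  then have "y = g x" by (simp add: algebra_simps)
  then show "y \<in> g ` cball 0 r" using x(1) by blast
qed

lemma no_near_translation_through_hyperplane:
  fixes f :: "real^'q \<Rightarrow> real^'q" and H :: "real^'q \<Rightarrow> real^'q"
  assumes f: "continuous_on (cball 0 r) f" "\<And>x. x \<in> cball 0 r \<Longrightarrow> f x $ j = 0"
    and H: "continuous_on UNIV H"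
    and "r > 0" "s < r"
    and near: "\<And>x. x \<in> cball 0 r \<Longrightarrow> norm (H (f x) - a - x) \<le> s"
  shows False
proof -
  let ?e = "(r - s) / 2"
  have "compact (f ` cball 0 r)"
    using f(1) by (intro compact_continuous_image compact_cball)
  moreover have "continuous_on (f ` cball 0 r) H"
    using H by (rule continuous_on_subset) simp
  moreover have "0 < ?e" using \<open>s < r\<close> by simp
  ultimately have "\<exists>p. polynomial_function p \<and> (\<forall>y\<in>f ` cball 0 r. norm (H y - p y) < ?e)"
    by (rule Stone_Weierstrass_polynomial_function)
  then obtain p where p: "polynomial_function p"
      "\<And>y. y \<in> f ` cball 0 r \<Longrightarrow> norm (H y - p y) < ?e"
    by blast
  have "continuous_on (f ` cball 0 r) p"
    using p(1) by (rule continuous_on_polymonial_function)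
  then have cont: "continuous_on (cball 0 r) (p \<circ> f)"
    using f(1) by (intro continuous_on_compose)
  have "norm ((p \<circ> f) x - a - x) \<le> s + ?e" if "x \<in> cball 0 r" for x
  proof -
    have "norm ((p \<circ> f) x - a - x) = norm ((H (f x) - a - x) - (H (f x) - p (f x)))"
      by (simp add: algebra_simps)
    also have "\<dots> \<le> norm (H (f x) - a - x) + norm (H (f x) - p (f x))"
      by (rule norm_triangle_ineq4)
    finally show ?thesis
      using near[OF that] p(2)[OF imageI[OF that]] by linarith
  qed
  moreover have "s + ?e < r"
    using \<open>s < r\<close> by (simp add: field_simps)
  ultimately have "cball a (r - (s + ?e)) \<subseteq> (p \<circ> f) ` cball 0 r"
    by (intro near_translation_covers_ball[OF cont \<open>r > 0\<close>])
  also have "\<dots> \<subseteq> p ` {y. y $ j = 0}"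
    using f(2) by auto
  finally have "ball a (r - (s + ?e)) \<subseteq> p ` {y. y $ j = 0}"
    using ball_subset_cball by (rule order_trans[rotated])
  moreover have "negligible (p ` {y. y $ j = 0})"
    by (intro negligible_differentiable_image_negligible negligible_standard_hyperplane_cart
        differentiable_on_polynomial_function[OF p(1)] order_refl)
  ultimately have "negligible (ball a (r - (s + ?e)))"
    by (rule negligible_subset[rotated])
  moreover have "ball a (r - (s + ?e)) \<noteq> {}"
    using \<open>s + ?e < r\<close> by simp
  ultimately show False
    using open_not_negligible[OF open_ball] by blast
qed

section \<open>Sensing numbers of a patch\<close>

text \<open>Enumerating the coordinates of \<open>real^'q\<close> by \<open>c\<close> identifies it with the sequences that vanish
  from index \<open>CARD('q)\<close> on; truncating at \<open>n\<close> yields the first \<open>n\<close> coordinates.\<close>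
lemma continuous_map_truncated_coordinates:
  fixes c :: "nat \<Rightarrow> 'q::finite"
  shows "continuous_map euclidean (Euclidean_space n)
           (\<lambda>y::real^'q. \<lambda>i. if i < n then y $ c i else 0)"
  unfolding Euclidean_space_def continuous_map_in_subtopology continuous_map_componentwise_UNIV
proof (intro conjI allI)
  show "continuous_map euclidean euclideanreal (\<lambda>y::real^'q. if k < n then y $ c k else 0)" for k
    by (cases "k < n") (auto intro!: continuous_intros)
qed auto

lemma sensing_number_eq_0:
  fixes U :: "'a::topological_space \<Rightarrow> 'b::euclidean_space" and A :: "'b \<Rightarrow> real^'q"
  assumes "compact X" "continuous_on X U" "bounded_linear A" "inj_on (A \<circ> U) X"
  shows "sensing_number CARD('q) (U ` X) = 0"
proof -
  let ?n = "CARD('q)"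
  have contA: "continuous_on (U ` X) A"
    using assms(3) by (simp add: linear_continuous_on)
  have cont: "continuous_on X (A \<circ> U)"
    using assms contA by (intro continuous_on_compose)
  let ?Y = "(A \<circ> U) ` X"
  have "continuous_on ?Y (U \<circ> the_inv_into X (A \<circ> U))"
    using continuous_on_inv_into[OF cont assms(1,4)] assms(2)
    by (intro continuous_on_compose) (simp_all only: the_inv_into_onto[OF assms(4)])
  moreover have "closedin (top_of_set UNIV) ?Y"
    using compact_continuous_image[OF cont assms(1)] compact_imp_closed by simp
  ultimately obtain T where T: "continuous_on UNIV T"
      "\<And>y. y \<in> ?Y \<Longrightarrow> T y = (U \<circ> the_inv_into X (A \<circ> U)) y"
    using Tietze_unbounded[of ?Y _ UNIV] by blast
  have TAU: "T (A u) = u" if "u \<in> U ` X" for u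
    using that T(2) the_inv_into_f_f[OF assms(4)] by fastforce
  obtain c where c: "bij_betw c {0..<?n} (UNIV::'q set)"
    using ex_bij_betw_nat_finite[OF finite_class.finite_UNIV] by blast
  define idx where "idx = inv_into {0..<?n} c"
  have idx: "idx j < ?n" "c (idx j) = j" for j
    using c inv_into_into[of j c "{0..<?n}"] f_inv_into_f[of j c "{0..<?n}"]
    by (auto simp: idx_def bij_betw_def)
  define D where "D = (\<lambda>y. T (\<chi> j. y (idx j)))"
  define l where "l = (\<lambda>i. Blinfun (\<lambda>u. A u $ c i))"
  have l: "blinfun_apply (l i) u = A u $ c i" for i u
    using bounded_linear_compose[OF bounded_linear_vec_nth assms(3)]
    by (simp add: l_def bounded_linear_Blinfun_apply)
  have "continuous_on UNIV (\<lambda>y::nat \<Rightarrow> real. \<chi> j::'q. y (idx j))"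
    by (intro continuous_on_vec_lambda continuous_on_product_coordinates)
  then have "continuous_on UNIV D"
    unfolding D_def by (rule continuous_on_compose2[OF T(1)]) auto
  then have contD: "continuous_map (Euclidean_space ?n) euclidean D"
    unfolding Euclidean_space_def euclidean_product_topology
    by (intro continuous_map_from_subtopology) (simp only: continuous_map_iff_continuous2)
  have "D (\<lambda>i. if i < ?n then blinfun_apply (l i) u else 0) = u" if "u \<in> U ` X" for u
    using TAU[OF that] idx by (simp add: D_def l)
  then have "(SUP u\<in>U ` X. ennreal (norm (u - D (\<lambda>i. if i < ?n then blinfun_apply (l i) u else 0)))) = 0"
    by (intro antisym SUP_least) auto
  moreover have "sensing_number ?n (U ` X) \<le>
      (SUP u\<in>U ` X. ennreal (norm (u - D (\<lambda>i. if i < ?n then blinfun_apply (l i) u else 0))))"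
    unfolding sensing_number_def using contD by (intro INF_lower2[of "(D, l)"]) auto
  ultimately show ?thesis by simp
qed

lemma sensing_number_neq_0:
  fixes U :: "real^'q \<Rightarrow> 'b::euclidean_space" and A :: "'b \<Rightarrow> real^'q"
  assumes "n < CARD('q)" "r > 0" "continuous_on (cball 0 r) U" "bounded_linear A"
    and near: "\<And>x. x \<in> cball 0 r \<Longrightarrow> norm (A (U x) - a - x) \<le> r / 2"
  shows "sensing_number n (U ` cball 0 r) \<noteq> 0"
proof
  assume zero: "sensing_number n (U ` cball 0 r) = 0"
  obtain B where B: "B > 0" "\<And>u. norm (A u) \<le> norm u * B"
    using bounded_linear.pos_bounded[OF assms(4)] by blast
  \<comment> \<open>an error of \<open>e\<close> in the patch is one of at most \<open>r / 4\<close> after applying \<open>A\<close>, which together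
    with \<open>r / 2\<close> stays below \<open>r\<close>\<close>
  define e where "e = r / (4 * B)"
  have "e > 0" using B \<open>r > 0\<close> by (simp add: e_def)
  then have "sensing_number n (U ` cball 0 r) < ennreal e"
    using zero by simp
  then obtain D and l :: "nat \<Rightarrow> 'b \<Rightarrow>\<^sub>L real"
    where D: "continuous_map (Euclidean_space n) euclidean D"
      and sup: "(SUP u\<in>U ` cball 0 r. ennreal (norm (u - D (\<lambda>i. if i < n then blinfun_apply (l i) u else 0)))) < ennreal e"
    unfolding sensing_number_def INF_less_iff by auto
  have err: "norm (U x - D (\<lambda>i. if i < n then blinfun_apply (l i) (U x) else 0)) \<le> e"
    if "x \<in> cball 0 r" for x
  proof -
    have "ennreal (norm (U x - D (\<lambda>i. if i < n then blinfun_apply (l i) (U x) else 0))) \<le>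
        (SUP u\<in>U ` cball 0 r. ennreal (norm (u - D (\<lambda>i. if i < n then blinfun_apply (l i) u else 0))))"
      using that by (intro SUP_upper) auto
    then have "ennreal (norm (U x - D (\<lambda>i. if i < n then blinfun_apply (l i) (U x) else 0))) \<le> ennreal e"
      using sup by simp
    then show ?thesis
      using \<open>e > 0\<close> by simp
  qed
  obtain c where c: "bij_betw c {0..<CARD('q)} (UNIV::'q set)"
    using ex_bij_betw_nat_finite[OF finite_class.finite_UNIV] by blast
  define idx where "idx = inv_into {0..<CARD('q)} c"
  have idx: "idx (c i) = i" if "i < CARD('q)" for i
    using c that by (simp add: idx_def bij_betw_def)
  \<comment> \<open>\<open>f\<close> records the measurements in the first \<open>n\<close> coordinates; as \<open>n < q\<close>, the coordinate \<open>c n\<close>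
    stays free and defines the hyperplane\<close>
  define trunc where "trunc = (\<lambda>y::real^'q. \<lambda>i. if i < n then y $ c i else 0)"
  define f :: "real^'q \<Rightarrow> real^'q"
    where "f = (\<lambda>x. \<chi> j. if idx j < n then blinfun_apply (l (idx j)) (U x) else 0)"
  have trunc_f: "trunc (f x) = (\<lambda>i. if i < n then blinfun_apply (l i) (U x) else 0)" for x
    using idx \<open>n < CARD('q)\<close> by (auto simp: trunc_def f_def)
  have contf: "continuous_on (cball 0 r) f"
    unfolding f_def
  proof (intro continuous_on_vec_lambda)
    fix j
    show "continuous_on (cball 0 r) (\<lambda>x. if idx j < n then blinfun_apply (l (idx j)) (U x) else 0)"
      using assms(3) by (cases "idx j < n") (auto intro!: continuous_intros)
  qed
  have hyper: "f x $ c n = 0" for x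
    using idx[OF \<open>n < CARD('q)\<close>] by (simp add: f_def)
  have "continuous_map euclidean euclidean (D \<circ> trunc)"
    unfolding trunc_def by (rule continuous_map_compose[OF continuous_map_truncated_coordinates D])
  then have "continuous_on UNIV (D \<circ> trunc)"
    by (simp only: continuous_map_iff_continuous2)
  then have "continuous_on UNIV (A \<circ> (D \<circ> trunc))"
    by (rule continuous_on_compose) (intro linear_continuous_on assms(4))
  moreover have "norm ((A \<circ> (D \<circ> trunc)) (f x) - a - x) \<le> 3 / 4 * r" if "x \<in> cball 0 r" for x
  proof -
    let ?v = "D (trunc (f x))"
    have "norm (A (U x - ?v)) \<le> norm (U x - ?v) * B"
      by (rule B(2))
    also have "\<dots> \<le> e * B"
      using err[OF that] B(1) by (simp add: trunc_f)
    also have "\<dots> = r / 4"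
      using B(1) by (simp add: e_def)
    finally have Ae: "norm (A (U x - ?v)) \<le> r / 4" .
    have "A ?v - a - x = (A (U x) - a - x) - A (U x - ?v)"
      by (simp add: linear_diff[OF bounded_linear.linear[OF assms(4)]])
    then have "norm (A ?v - a - x) \<le> norm (A (U x) - a - x) + norm (A (U x - ?v))"
      by (simp only: norm_triangle_ineq4)
    then have "norm (A ?v - a - x) \<le> 3 / 4 * r"
      using near[OF that] Ae by linarith
    then show ?thesis by simp
  qed
  ultimately show False
    using no_near_translation_through_hyperplane[OF contf hyper _ \<open>r > 0\<close>, of _ "3 / 4 * r" a] \<open>r > 0\<close>
    by fastforce
qed

theorem mainTheorem2:
  fixes S :: "(real^'m) set" and ustar :: "real^'m"
    and Q0 :: "(real^'q) set" and U :: "real^'q \<Rightarrow> real^'m" and k :: nat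
  assumes "1 \<le> k" and "embedded_submanifold k CARD('q) S" and "ustar \<in> S"
    and "open Q0" and "cball 0 1 \<subseteq> Q0"
    and "openin (top_of_set S) (U ` Q0)" and "\<exists>chart. homeomorphism Q0 (U ` Q0) U chart"
    and "U 0 = ustar"
    and "C_k_on 3 U Q0"
    and "\<forall>\<nu>\<in>Q0. rank (jacobian U (at \<nu>)) = CARD('q)"
    and "\<forall>\<nu>\<in>Q0. second_fundamental_form_max_rank U \<nu>"
  shows "\<exists>r0>0. \<forall>r. 0 < r \<and> r < r0 \<longrightarrow>
           minimal_latent_dim (U ` cball 0 r) = enat CARD('q)"
proof -
  have "0 \<in> Q0" by (rule subsetD[OF assms(5)]) simp
  have "C_k_on (Suc (Suc 1)) U Q0"
    using assms(9) by (simp add: eval_nat_numeral del: C_k_on.simps)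
  then have C1: "C_k_on 1 U Q0"
    by (rule C_k_on_Suc_imp[OF C_k_on_Suc_imp])
  have "(*v) (jacobian U (at 0)) = frechet_derivative U (at 0)"
    using C1 \<open>0 \<in> Q0\<close>
    by (auto simp: jacobian_def fun_eq_iff matrix_works linear_frechet_derivative)
  then have "inj (frechet_derivative U (at 0))"
    using assms(10) \<open>0 \<in> Q0\<close> by (metis full_rank_injective)
  then obtain A d where A: "bounded_linear A" "d > 0" "ball 0 d \<subseteq> Q0"
    and near: "\<And>x y. x \<in> ball 0 d \<Longrightarrow> y \<in> ball 0 d \<Longrightarrow>
       norm (A (U x) - A (U y) - (x - y)) \<le> norm (x - y) / 2"
    using immersion_near_translation[OF C1 \<open>open Q0\<close> \<open>0 \<in> Q0\<close>] by metis
  have contU: "continuous_on Q0 U"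
    using C1 C_k_on_Suc_imp[of 0 U Q0] by simp
  have "minimal_latent_dim (U ` cball 0 r) = enat CARD('q)" if r: "0 < r" "r < d" for r
  proof -
    have sub: "cball 0 r \<subseteq> ball (0::real^'q) d" using r by auto
    have cont: "continuous_on (cball 0 r) U"
      using contU sub A(3) continuous_on_subset by blast
    have "inj_on (A \<circ> U) (cball 0 r)"
    proof (rule inj_onI)
      fix x y :: "real^'q" assume "x \<in> cball 0 r" "y \<in> cball 0 r" "(A \<circ> U) x = (A \<circ> U) y"
      then have "norm (x - y) \<le> norm (x - y) / 2"
        using near[of x y] sub by (simp add: norm_minus_commute subset_iff)
      then show "x = y" by simp
    qed
    then have zero: "sensing_number CARD('q) (U ` cball 0 r) = 0"
      using sensing_number_eq_0[OF compact_cball cont A(1)] by blast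
    have "norm (A (U x) - A (U 0) - x) \<le> r / 2" if "x \<in> cball 0 r" for x
      using near[of x 0] that sub \<open>d > 0\<close> by (auto simp: subset_iff)
    then have "sensing_number n (U ` cball 0 r) \<noteq> 0" if "n < CARD('q)" for n
      using sensing_number_neq_0[OF that r(1) cont A(1)] by blast
    then show ?thesis
      unfolding minimal_latent_dim_def using zero
      by (intro antisym Inf_lower Inf_greatest) (auto simp: not_less[symmetric])
  qed
  then show ?thesis using \<open>d > 0\<close> by blast
qed

end
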